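(* Let $G$ be an arbitrary directed graph on vertex set $U=U_0\cup U_1$ (disjoint union) and $H$ a directed graph on vertex set $V=V_0\cup V_1$ (disjoint union), with partitioned adjacency matrices $G=\begin{pmatrix}G_{00}&G_{01}\\ G_{10}&G_{11}\end{pmatrix}$ and $H=\begin{pmatrix}H_{00}&H_{01}\\ H_{10}&H_{11}\end{pmatrix}$. Let $l=\min(|U_0|,|U_1|)$. Suppose $G_{01}=QSR^{-1}$ and $G_{10}=RTQ^{-1}$, where $Q$ is a nonsingular $|U_0|\times|U_0|$ complex matrix, $R$ is a nonsingular $|U_1|\times|U_1|$ complex matrix, $S$ is $|U_0|\times|U_1|$, $T$ is $|U_1|\times|U_0|$, $S_{ij}=T_{ij}=0$ for $i>j$, and for each $1\le j\le l$ either $S_{jj}=T_{jj}$ or $S_{jj}T_{jj}=0$. Let $(\sigma_1,\ldots,\sigma_l)$ be such that, for each $j$, either $\sigma_j=S_{jj}=T_{jj}$ or $\sigma_j=0=S_{jj}T_{jj}$. Then $$p(G\,\underline{\times}\,H)=\begin{cases}\left(\prod_{j=1}^l p(H\uparrow\sigma_j)\right)p(H_{00})^{|U_0|-|U_1|}, & \text{if } |U_0|\ge |U_1|;\\[4pt] \left(\prod_{j=1}^l p(H\uparrow\sigma_j)\right)p(H_{11})^{|U_1|-|U_0|}, & \text{if } |U_1|\ge |U_0|.\end{cases}$$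
   Context: Graphs are identified with their adjacency matrices (nonnegative integer entries; multiple arcs allowed). $G_{ij}$ is the $|U_i|\times|U_j|$ submatrix of arcs of $G$ from $U_i$ to $U_j$; $H_{ij}$ is the $|V_i|\times|V_j|$ submatrix of arcs of $H$ from $V_i$ to $V_j$. The partitioned tensor product is the matrix $$G\,\underline{\times}\,H=\begin{pmatrix} I_{|U_0|}\otimes H_{00} & G_{01}\otimes H_{01}\\ G_{10}\otimes H_{10} & I_{|U_1|}\otimes H_{11}\end{pmatrix},$$ where $\otimes$ is the Kronecker product and $I_k$ the $k\times k$ identity. For a complex number $\sigma$, $H\uparrow\sigma=\begin{pmatrix}H_{00}&\sigma H_{01}\\ \sigma H_{10}&H_{11}\end{pmatrix}$. For a square matrix $M$, $p(M)=\det(\lambda I-M)$ is its characteristic polynomial (with $p$ of a $0\times0$ matrix equal to $1$). (Such a decomposition of $G_{01},G_{10}$ always exists.) *)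

theory Defs
  imports
    Complex_Main
    "Jordan_Normal_Form.Matrix"
    "Jordan_Normal_Form.Char_Poly"
    "Jordan_Normal_Form.Gauss_Jordan_Elimination"
begin

text \<open>
  A directed graph (multiple arcs and loops allowed) is its adjacency matrix, of type
  \<^typ>\<open>nat mat\<close>. A partition of its vertex set into two (possibly empty) parts is given by
  the size of the first part; the vertices are ordered so that this part comes first, and
  \<^const>\<open>split_block\<close> returns the four blocks in the order 00, 01, 10, 11.
\<close>

abbreviation cmat :: "nat mat \<Rightarrow> complex mat" where
  "cmat \<equiv> map_mat of_nat"

definition kronecker :: "'a :: semiring_1 mat \<Rightarrow> 'a mat \<Rightarrow> 'a mat" (infixl \<open>\<otimes>\<^sub>K\<close> 70) where
  "A \<otimes>\<^sub>K B = mat (dim_row A * dim_row B) (dim_col A * dim_col B)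
     (\<lambda>(i, j). A $$ (i div dim_row B, j div dim_col B) * B $$ (i mod dim_row B, j mod dim_col B))"

text \<open>Here \<open>u\<^sub>0\<close> and \<open>v\<^sub>0\<close> are the sizes of the first parts of the vertex sets of
  \<open>G\<close> and \<open>H\<close>. The diagonal blocks of \<open>G\<close> contribute only their dimensions.\<close>

definition partitioned_tensor :: "nat \<Rightarrow> nat \<Rightarrow> nat mat \<Rightarrow> nat mat \<Rightarrow> nat mat" where
  "partitioned_tensor u\<^sub>0 v\<^sub>0 G H =
     (case split_block G u\<^sub>0 u\<^sub>0 of (G00, G01, G10, G11) \<Rightarrow>
      case split_block H v\<^sub>0 v\<^sub>0 of (H00, H01, H10, H11) \<Rightarrow>
        four_block_mat (1\<^sub>m (dim_row G00) \<otimes>\<^sub>K H00) (G01 \<otimes>\<^sub>K H01)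
                       (G10 \<otimes>\<^sub>K H10) (1\<^sub>m (dim_row G11) \<otimes>\<^sub>K H11))"

definition scale_off_diagonal :: "nat \<Rightarrow> nat mat \<Rightarrow> complex \<Rightarrow> complex mat" where
  "scale_off_diagonal v\<^sub>0 H \<sigma> =
     (case split_block H v\<^sub>0 v\<^sub>0 of (H00, H01, H10, H11) \<Rightarrow>
        four_block_mat (cmat H00) (\<sigma> \<cdot>\<^sub>m cmat H01) (\<sigma> \<cdot>\<^sub>m cmat H10) (cmat H11))"

text \<open>\<^const>\<open>mat_inverse\<close> is option-valued; this is only meaningful for invertible matrices.\<close>

abbreviation minv :: "complex mat \<Rightarrow> complex mat" where
  "minv A \<equiv> the (mat_inverse A)"

end

theory Submission
  imports Defs
begin

text \<open>
  Evaluate the characteristic polynomial at a point \<open>x\<close> at which \<open>A = x I - H\<^sub>0\<^sub>0\<close> is invertible;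
  there are enough such points to determine it. The Schur complement of the block \<open>I \<otimes> A\<close> of
  the resolvent is \<open>I \<otimes> (x I - H\<^sub>1\<^sub>1) - G\<^sub>1\<^sub>0 G\<^sub>0\<^sub>1 \<otimes> E\<close> with \<open>E = H\<^sub>1\<^sub>0 A\<inverse> H\<^sub>0\<^sub>1\<close>, and
  \<open>G\<^sub>1\<^sub>0 G\<^sub>0\<^sub>1 = R (T S) R\<inverse>\<close>, where \<open>T S\<close> is upper triangular with diagonal \<open>\<sigma>\<^sub>j\<^sup>2\<close>, padded
  by zeros. So its determinant is a product of factors \<open>det (x I - H\<^sub>1\<^sub>1 - \<sigma>\<^sub>j\<^sup>2 E)\<close>, each of
  which is, up to \<open>det A\<close>, the value of \<open>p (H \<up> \<sigma>\<^sub>j)\<close> at \<open>x\<close>.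
\<close>

section \<open>Index arithmetic and the algebra of Kronecker products\<close>

text \<open>Every index below \<open>p * q\<close> corresponds to exactly one pair of quotient and
  remainder modulo \<open>q\<close>, so a summand that separates in the two gives a product of sums.
  This is the sum over the inner index in a product of Kronecker products.\<close>

lemma sum_div_mod:
  fixes f g :: "nat \<Rightarrow> 'a :: semiring_0"
  shows "(\<Sum>k<p * q. f (k div q) * g (k mod q)) = (\<Sum>i<p. f i) * (\<Sum>j<q. g j)"
proof -
  have "(\<Sum>k<p * q. f (k div q) * g (k mod q)) =
      (\<Sum>i<p. \<Sum>k\<in>{i * q..<i * q + q}. f (k div q) * g (k mod q))"
    by (rule sum.nat_group[symmetric])
  also have "\<dots> = (\<Sum>i<p. \<Sum>j<q. f i * g j)"
  proof (rule sum.cong[OF refl])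
    fix i
    have "(\<Sum>k\<in>{i * q..<i * q + q}. f (k div q) * g (k mod q)) =
        (\<Sum>j\<in>{0..<q}. f ((j + i * q) div q) * g ((j + i * q) mod q))"
      using sum.shift_bounds_nat_ivl[of "\<lambda>k. f (k div q) * g (k mod q)" 0 "i * q" q]
      by (simp add: add.commute)
    also have "\<dots> = (\<Sum>j<q. f i * g j)"
      by (rule sum.cong) auto
    finally show "(\<Sum>k\<in>{i * q..<i * q + q}. f (k div q) * g (k mod q)) = (\<Sum>j<q. f i * g j)" .
  qed
  finally show ?thesis
    by (simp add: sum_product)
qed

lemma kronecker_carrier [simp]:
  assumes "A \<in> carrier_mat m n" "B \<in> carrier_mat p q"
  shows "A \<otimes>\<^sub>K B \<in> carrier_mat (m * p) (n * q)"
  using assms by (auto simp: kronecker_def)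

lemma kronecker_dim [simp]:
  "dim_row (A \<otimes>\<^sub>K B) = dim_row A * dim_row B"
  "dim_col (A \<otimes>\<^sub>K B) = dim_col A * dim_col B"
  by (auto simp: kronecker_def)

lemma kronecker_index:
  assumes "A \<in> carrier_mat m n" "B \<in> carrier_mat p q" "i < m * p" "j < n * q"
  shows "(A \<otimes>\<^sub>K B) $$ (i, j) = A $$ (i div p, j div q) * B $$ (i mod p, j mod q)"
  using assms by (auto simp: kronecker_def)

lemma div_mod_less_mult:
  fixes i m p :: nat
  assumes "i < m * p"
  shows "i div p < m" "i mod p < p"
  using assms by (auto simp: less_mult_imp_div_less intro!: mod_less_divisor gr0I)

text \<open>The mixed-product rule: the inner index splits into its quotient and remainder modulo
  \<open>q\<close>, and the two vary independently.\<close>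

lemma kronecker_mult_distrib:
  fixes A B C D :: "'a :: comm_semiring_1 mat"
  assumes A: "A \<in> carrier_mat m n" and B: "B \<in> carrier_mat p q"
    and C: "C \<in> carrier_mat n r" and D: "D \<in> carrier_mat q s"
  shows "(A \<otimes>\<^sub>K B) * (C \<otimes>\<^sub>K D) = (A * C) \<otimes>\<^sub>K (B * D)"
proof (rule eq_matI)
  fix i j assume "i < dim_row ((A * C) \<otimes>\<^sub>K (B * D))" "j < dim_col ((A * C) \<otimes>\<^sub>K (B * D))"
  then have i: "i < m * p" and j: "j < r * s"
    using A B C D by auto
  note ij = div_mod_less_mult[OF i] div_mod_less_mult[OF j]
  have "((A \<otimes>\<^sub>K B) * (C \<otimes>\<^sub>K D)) $$ (i, j) =
      (\<Sum>k<n * q. (A \<otimes>\<^sub>K B) $$ (i, k) * (C \<otimes>\<^sub>K D) $$ (k, j))"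
    using A B C D i j by (auto simp: scalar_prod_def atLeast0LessThan)
  also have "\<dots> = (\<Sum>k<n * q. (A $$ (i div p, k div q) * C $$ (k div q, j div s)) *
      (B $$ (i mod p, k mod q) * D $$ (k mod q, j mod s)))"
    using i j by (intro sum.cong refl) (simp add: kronecker_index[OF A B] kronecker_index[OF C D] ac_simps)
  also have "\<dots> = (\<Sum>k<n. A $$ (i div p, k) * C $$ (k, j div s)) *
      (\<Sum>k<q. B $$ (i mod p, k) * D $$ (k, j mod s))"
    by (rule sum_div_mod)
  also have "\<dots> = (A * C) $$ (i div p, j div s) * (B * D) $$ (i mod p, j mod s)"
    using A B C D ij by (auto simp: scalar_prod_def atLeast0LessThan)
  also have "\<dots> = ((A * C) \<otimes>\<^sub>K (B * D)) $$ (i, j)"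
    by (rule kronecker_index[symmetric, OF _ _ i j]) (use A B C D in auto)
  finally show "((A \<otimes>\<^sub>K B) * (C \<otimes>\<^sub>K D)) $$ (i, j) = ((A * C) \<otimes>\<^sub>K (B * D)) $$ (i, j)" .
qed (use A B C D in auto)

lemma div_mod_eq_iff:
  fixes i j p :: nat
  shows "i div p = j div p \<and> i mod p = j mod p \<longleftrightarrow> i = j"
  by (metis div_mult_mod_eq)

lemma one_kronecker_one: "1\<^sub>m n \<otimes>\<^sub>K 1\<^sub>m p = (1\<^sub>m (n * p) :: 'a :: semiring_1 mat)"
proof (rule eq_matI)
  fix i j assume "i < dim_row (1\<^sub>m (n * p) :: 'a mat)" "j < dim_col (1\<^sub>m (n * p) :: 'a mat)"
  then have i: "i < n * p" and j: "j < n * p" by auto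
  note ij = div_mod_less_mult[OF i] div_mod_less_mult[OF j]
  have "(1\<^sub>m n \<otimes>\<^sub>K 1\<^sub>m p) $$ (i, j) =
      (1\<^sub>m n $$ (i div p, j div p) * 1\<^sub>m p $$ (i mod p, j mod p) :: 'a)"
    by (rule kronecker_index[OF _ _ i j]) auto
  also have "\<dots> = 1\<^sub>m (n * p) $$ (i, j)"
    using i j ij div_mod_eq_iff[of i p j] by auto
  finally show "(1\<^sub>m n \<otimes>\<^sub>K 1\<^sub>m p) $$ (i, j) = (1\<^sub>m (n * p) $$ (i, j) :: 'a)" .
qed auto

lemma cmat_kronecker: "cmat (A \<otimes>\<^sub>K B) = cmat A \<otimes>\<^sub>K cmat B"
proof (rule eq_matI)
  fix i j assume "i < dim_row (cmat A \<otimes>\<^sub>K cmat B)" "j < dim_col (cmat A \<otimes>\<^sub>K cmat B)"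
  then have i: "i < dim_row A * dim_row B" and j: "j < dim_col A * dim_col B" by auto
  then show "cmat (A \<otimes>\<^sub>K B) $$ (i, j) = (cmat A \<otimes>\<^sub>K cmat B) $$ (i, j)"
    using div_mod_less_mult[OF i] div_mod_less_mult[OF j] by (auto simp: kronecker_def)
qed auto

section \<open>Determinants of block matrices\<close>

text \<open>Induction on the number of blocks, splitting off the last diagonal one; what lies to its
  left vanishes, so the determinant factors.\<close>

lemma det_block_upper_triangular:
  fixes M :: "'a :: idom mat"
  assumes M: "M \<in> carrier_mat (n * m) (n * m)"
    and zero: "\<And>i j. i < n * m \<Longrightarrow> j < n * m \<Longrightarrow> j div m < i div m \<Longrightarrow> M $$ (i, j) = 0"
  shows "det M = (\<Prod>k<n. det (mat m m (\<lambda>(i, j). M $$ (k * m + i, k * m + j))))"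
  using assms
proof (induction n arbitrary: M)
  case 0
  then show ?case by simp
next
  case (Suc n)
  obtain A B C D where split: "split_block M (n * m) (n * m) = (A, B, C, D)"
    by (cases "split_block M (n * m) (n * m)")
  have dims: "dim_row M = n * m + m" "dim_col M = n * m + m"
    using Suc.prems(1) by auto
  note block = split_block[OF split dims]
  have A: "A = mat (n * m) (n * m) (\<lambda>(i, j). M $$ (i, j))"
    and D: "D = mat m m (\<lambda>(i, j). M $$ (n * m + i, n * m + j))"
    and C: "C = mat m (n * m) (\<lambda>(i, j). M $$ (n * m + i, j))"
    using split dims by (auto simp: split_block_def Let_def add.commute)
  \<comment> \<open>Rows of \<open>C\<close> have block number \<open>n\<close>, its columns have
    block numbers below \<open>n\<close>.\<close>
  have C0: "C = 0\<^sub>m m (n * m)"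
  proof (rule eq_matI)
    fix i j assume "i < dim_row (0\<^sub>m m (n * m) :: 'a mat)" "j < dim_col (0\<^sub>m m (n * m) :: 'a mat)"
    then have i: "i < m" and j: "j < n * m" by auto
    have "M $$ (n * m + i, j) = 0"
      by (rule Suc.prems(2)) (use i j in \<open>auto simp: less_mult_imp_div_less\<close>)
    then show "C $$ (i, j) = 0\<^sub>m m (n * m) $$ (i, j)"
      using i j by (auto simp: C)
  qed (use block in auto)
  have "det M = det A * det D"
    using block(5) det_four_block_mat_lower_left_zero[OF block(1,2) C0 block(4)] by simp
  also have "det A = (\<Prod>k<n. det (mat m m (\<lambda>(i, j). A $$ (k * m + i, k * m + j))))"
  proof (rule Suc.IH[OF block(1)])
    fix i j assume "i < n * m" "j < n * m" "j div m < i div m"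
    then show "A $$ (i, j) = 0"
      using Suc.prems(2)[of i j] by (auto simp: A)
  qed
  also have "\<dots> = (\<Prod>k<n. det (mat m m (\<lambda>(i, j). M $$ (k * m + i, k * m + j))))"
  proof (intro prod.cong refl arg_cong[where f = det] cong_mat, clarsimp)
    fix k i j assume k: "k < n" and ij: "i < m" "j < m"
    have "k * m + m \<le> n * m"
      using k by (metis Suc_leI add.commute mult_Suc mult_le_mono1)
    then show "A $$ (k * m + i, k * m + j) = M $$ (k * m + i, k * m + j)"
      using ij by (auto simp: A)
  qed
  finally show ?case
    by (simp add: D)
qed

text \<open>For upper triangular \<open>Z\<close> this matrix is block upper triangular, and its
  diagonal blocks are the factors on the right.\<close>

lemma det_one_kronecker_minus:
  fixes D E Z :: "'a :: idom mat"
  assumes D: "D \<in> carrier_mat m m" and E: "E \<in> carrier_mat m m"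
    and Z: "Z \<in> carrier_mat n n" and upper: "upper_triangular Z"
  shows "det (1\<^sub>m n \<otimes>\<^sub>K D - Z \<otimes>\<^sub>K E) = (\<Prod>k<n. det (D - Z $$ (k, k) \<cdot>\<^sub>m E))"
proof -
  let ?M = "1\<^sub>m n \<otimes>\<^sub>K D - Z \<otimes>\<^sub>K E"
  have M: "?M \<in> carrier_mat (n * m) (n * m)"
    using D E Z by auto
  have index: "?M $$ (i, j) = 1\<^sub>m n $$ (i div m, j div m) * D $$ (i mod m, j mod m)
      - Z $$ (i div m, j div m) * E $$ (i mod m, j mod m)" if "i < n * m" "j < n * m" for i j
    using that D E Z by (simp add: kronecker_index[OF one_carrier_mat D] kronecker_index[OF Z E])
  have "det ?M = (\<Prod>k<n. det (mat m m (\<lambda>(i, j). ?M $$ (k * m + i, k * m + j))))"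
  proof (rule det_block_upper_triangular[OF M])
    fix i j assume i: "i < n * m" and j: "j < n * m" and less: "j div m < i div m"
    then show "?M $$ (i, j) = 0"
      using div_mod_less_mult[OF i] div_mod_less_mult[OF j] upper Z by (auto simp: index)
  qed
  also have "\<dots> = (\<Prod>k<n. det (D - Z $$ (k, k) \<cdot>\<^sub>m E))"
  proof (intro prod.cong refl arg_cong[where f = det] eq_matI)
    fix k i j
    assume k: "k \<in> {..<n}" and "i < dim_row (D - Z $$ (k, k) \<cdot>\<^sub>m E)"
      "j < dim_col (D - Z $$ (k, k) \<cdot>\<^sub>m E)"
    then have ij: "i < m" "j < m" using E by auto
    have "k * m + m \<le> n * m"
      using k by (metis Suc_leI add.commute lessThan_iff mult_Suc mult_le_mono1)
    then have "k * m + i < n * m" "k * m + j < n * m"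
      using ij by auto
    from index[OF this]
    show "mat m m (\<lambda>(i, j). ?M $$ (k * m + i, k * m + j)) $$ (i, j) =
        (D - Z $$ (k, k) \<cdot>\<^sub>m E) $$ (i, j)"
      using ij k D E by simp
  qed (use E in auto)
  finally show ?thesis .
qed

text \<open>The preceding determinant with \<open>Z = 0\<close>; \<open>A\<close> serves as
  \<open>E\<close> only to have the right size.\<close>

lemma det_one_kronecker:
  fixes A :: "'a :: idom mat"
  assumes A: "A \<in> carrier_mat m m"
  shows "det (1\<^sub>m n \<otimes>\<^sub>K A) = det A ^ n"
proof -
  have "1\<^sub>m n \<otimes>\<^sub>K A - 0\<^sub>m n n \<otimes>\<^sub>K A = 1\<^sub>m n \<otimes>\<^sub>K A"
    using A by (intro eq_matI) (auto simp: kronecker_def div_mod_less_mult)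
  moreover have "A - 0 \<cdot>\<^sub>m A = A"
    using A by (intro eq_matI) auto
  ultimately show ?thesis
    using det_one_kronecker_minus[OF A A zero_carrier_mat[of n n]] by (simp add: upper_triangular_def)
qed

text \<open>Multiplying on the right by a block unitriangular matrix, of determinant 1, clears the
  block \<open>B\<close>. The inverse enters as a witness \<open>A'\<close>, so that the statement
  makes sense over an integral domain.\<close>

lemma det_schur_complement:
  fixes A :: "'a :: idom mat"
  assumes A: "A \<in> carrier_mat m m" and B: "B \<in> carrier_mat m n"
    and C: "C \<in> carrier_mat n m" and D: "D \<in> carrier_mat n n"
    and A': "A' \<in> carrier_mat m m" and inv: "A * A' = 1\<^sub>m m"
  shows "det (four_block_mat A B C D) = det A * det (D - C * A' * B)"
proof -
  let ?L = "four_block_mat A B C D"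
  let ?N = "four_block_mat (1\<^sub>m m) (- (A' * B)) (0\<^sub>m n m) (1\<^sub>m n)"
  have AB: "A' * B \<in> carrier_mat m n" using A' B by auto
  have "A * - (A' * B) + B = - (A * (A' * B)) + B"
    using A AB by (subst uminus_mult_right_mat) auto
  also have "A * (A' * B) = B"
    using assoc_mult_mat[OF A A' B] inv B by simp
  also have "- B + B = 0\<^sub>m m n"
    using B by (intro eq_matI) auto
  finally have AB0: "A * - (A' * B) + B = 0\<^sub>m m n" .
  have "C * - (A' * B) + D = D - C * A' * B"
  proof -
    have "C * - (A' * B) = - (C * A' * B)"
      using C AB assoc_mult_mat[OF C A' B] by (subst uminus_mult_right_mat) auto
    then show ?thesis
      using A' B C D by (intro eq_matI) auto
  qed
  with AB0 have "?L * ?N = four_block_mat A (0\<^sub>m m n) C (D - C * A' * B)"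
    using A B C D AB
    by (subst mult_four_block_mat[of _ m m _ n _ n _ _ m _ n]) auto
  moreover have "det ?N = 1"
    using AB by (subst det_four_block_mat_lower_left_zero[of _ m _ n]) auto
  moreover have "det (?L * ?N) = det ?L * det ?N"
    using A B C D by (intro det_mult[of _ "m + n"]) auto
  moreover have "D - C * A' * B \<in> carrier_mat n n"
    using A' B C D by auto
  ultimately show ?thesis
    using det_four_block_mat_upper_right_zero[OF A refl C] by simp
qed

text \<open>By the mixed-product rule the Schur complement is \<open>1 \<otimes>\<^sub>K D\<close>
  minus \<open>(Y * X) \<otimes>\<^sub>K E\<close> with \<open>E = C * A' * B\<close>. Conjugation
  by \<open>P \<otimes>\<^sub>K 1\<close> turns \<open>Y * X\<close> into the triangular
  \<open>Z\<close> and fixes the first term.\<close>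

lemma det_four_block_kronecker:
  fixes A B C D X Y Z P P' :: "'a :: idom mat"
  assumes A: "A \<in> carrier_mat m\<^sub>0 m\<^sub>0" and B: "B \<in> carrier_mat m\<^sub>0 m\<^sub>1"
    and C: "C \<in> carrier_mat m\<^sub>1 m\<^sub>0" and D: "D \<in> carrier_mat m\<^sub>1 m\<^sub>1"
    and A': "A' \<in> carrier_mat m\<^sub>0 m\<^sub>0" and inv: "A * A' = 1\<^sub>m m\<^sub>0"
    and X: "X \<in> carrier_mat n\<^sub>0 n\<^sub>1" and Y: "Y \<in> carrier_mat n\<^sub>1 n\<^sub>0"
    and wit: "similar_mat_wit (Y * X) Z P P'" and upper: "upper_triangular Z"
  shows "det (four_block_mat (1\<^sub>m n\<^sub>0 \<otimes>\<^sub>K A) (X \<otimes>\<^sub>K B) (Y \<otimes>\<^sub>K C) (1\<^sub>m n\<^sub>1 \<otimes>\<^sub>K D)) =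
    det A ^ n\<^sub>0 * (\<Prod>k<n\<^sub>1. det (D - Z $$ (k, k) \<cdot>\<^sub>m (C * A' * B)))"
proof -
  have YX: "Y * X \<in> carrier_mat n\<^sub>1 n\<^sub>1" using X Y by auto
  note wit = similar_mat_witD2[OF YX wit]
  let ?E = "C * A' * B"
  have E: "?E \<in> carrier_mat m\<^sub>1 m\<^sub>1" using A' B C by auto
  have "(1\<^sub>m n\<^sub>0 \<otimes>\<^sub>K A) * (1\<^sub>m n\<^sub>0 \<otimes>\<^sub>K A') = 1\<^sub>m (n\<^sub>0 * m\<^sub>0)"
    using kronecker_mult_distrib[OF one_carrier_mat A one_carrier_mat A', of n\<^sub>0] inv
    by (simp add: one_kronecker_one)
  then have schur: "det (four_block_mat (1\<^sub>m n\<^sub>0 \<otimes>\<^sub>K A) (X \<otimes>\<^sub>K B) (Y \<otimes>\<^sub>K C) (1\<^sub>m n\<^sub>1 \<otimes>\<^sub>K D)) =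
      det (1\<^sub>m n\<^sub>0 \<otimes>\<^sub>K A) *
      det (1\<^sub>m n\<^sub>1 \<otimes>\<^sub>K D - (Y \<otimes>\<^sub>K C) * (1\<^sub>m n\<^sub>0 \<otimes>\<^sub>K A') * (X \<otimes>\<^sub>K B))"
    using A B C D A' X Y by (intro det_schur_complement) auto
  have "(Y \<otimes>\<^sub>K C) * (1\<^sub>m n\<^sub>0 \<otimes>\<^sub>K A') * (X \<otimes>\<^sub>K B) = (Y * X) \<otimes>\<^sub>K ?E"
    using kronecker_mult_distrib[OF Y C one_carrier_mat A']
      kronecker_mult_distrib[OF Y mult_carrier_mat[OF C A'] X B] Y by simp
  also have "\<dots> = (P \<otimes>\<^sub>K 1\<^sub>m m\<^sub>1) * (Z \<otimes>\<^sub>K ?E) * (P' \<otimes>\<^sub>K 1\<^sub>m m\<^sub>1)"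
    using kronecker_mult_distrib[OF wit(6) one_carrier_mat wit(5) E]
      kronecker_mult_distrib[OF mult_carrier_mat[OF wit(6,5)] E wit(7) one_carrier_mat] wit(3)
    by (simp only: left_mult_one_mat[OF E] right_mult_one_mat[OF E])
  finally have conj2: "(Y \<otimes>\<^sub>K C) * (1\<^sub>m n\<^sub>0 \<otimes>\<^sub>K A') * (X \<otimes>\<^sub>K B) =
      (P \<otimes>\<^sub>K 1\<^sub>m m\<^sub>1) * (Z \<otimes>\<^sub>K ?E) * (P' \<otimes>\<^sub>K 1\<^sub>m m\<^sub>1)" .
  \<comment> \<open>The two outer factors act on the first tensor factor only, where they multiply
    to \<open>P * P' = 1\<close>.\<close>
  have conj1: "1\<^sub>m n\<^sub>1 \<otimes>\<^sub>K D = (P \<otimes>\<^sub>K 1\<^sub>m m\<^sub>1) * (1\<^sub>m n\<^sub>1 \<otimes>\<^sub>K D) * (P' \<otimes>\<^sub>K 1\<^sub>m m\<^sub>1)"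
    using kronecker_mult_distrib[OF wit(6) one_carrier_mat one_carrier_mat D]
      kronecker_mult_distrib[OF wit(6) D wit(7) one_carrier_mat] wit(1,6) D
    by simp
  have carriers: "P \<otimes>\<^sub>K 1\<^sub>m m\<^sub>1 \<in> carrier_mat (n\<^sub>1 * m\<^sub>1) (n\<^sub>1 * m\<^sub>1)"
    "P' \<otimes>\<^sub>K 1\<^sub>m m\<^sub>1 \<in> carrier_mat (n\<^sub>1 * m\<^sub>1) (n\<^sub>1 * m\<^sub>1)"
    "1\<^sub>m n\<^sub>1 \<otimes>\<^sub>K D \<in> carrier_mat (n\<^sub>1 * m\<^sub>1) (n\<^sub>1 * m\<^sub>1)"
    "Z \<otimes>\<^sub>K ?E \<in> carrier_mat (n\<^sub>1 * m\<^sub>1) (n\<^sub>1 * m\<^sub>1)"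
    using wit(5-7) D E by (auto simp del: kronecker_dim)
  \<comment> \<open>A single \<open>subst\<close> is used for \<open>conj1\<close>, since its
    right-hand side contains its left-hand side and would be rewritten forever.\<close>
  have "1\<^sub>m n\<^sub>1 \<otimes>\<^sub>K D - (Y \<otimes>\<^sub>K C) * (1\<^sub>m n\<^sub>0 \<otimes>\<^sub>K A') * (X \<otimes>\<^sub>K B) =
      (P \<otimes>\<^sub>K 1\<^sub>m m\<^sub>1) * (1\<^sub>m n\<^sub>1 \<otimes>\<^sub>K D - Z \<otimes>\<^sub>K ?E) * (P' \<otimes>\<^sub>K 1\<^sub>m m\<^sub>1)"
    unfolding conj2 using carriers
    by (subst conj1) (simp add: mult_minus_distrib_mat[of _ "n\<^sub>1 * m\<^sub>1" "n\<^sub>1 * m\<^sub>1" _ "n\<^sub>1 * m\<^sub>1"]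
        minus_mult_distrib_mat[of _ "n\<^sub>1 * m\<^sub>1" "n\<^sub>1 * m\<^sub>1" _ _ "n\<^sub>1 * m\<^sub>1"])
  moreover have "(P \<otimes>\<^sub>K 1\<^sub>m m\<^sub>1) * (P' \<otimes>\<^sub>K 1\<^sub>m m\<^sub>1) = 1\<^sub>m (n\<^sub>1 * m\<^sub>1)"
    using kronecker_mult_distrib[OF wit(6) one_carrier_mat wit(7) one_carrier_mat, of m\<^sub>1] wit(1)
    by (simp add: one_kronecker_one)
  moreover have "(P' \<otimes>\<^sub>K 1\<^sub>m m\<^sub>1) * (P \<otimes>\<^sub>K 1\<^sub>m m\<^sub>1) = 1\<^sub>m (n\<^sub>1 * m\<^sub>1)"
    using kronecker_mult_distrib[OF wit(7) one_carrier_mat wit(6) one_carrier_mat, of m\<^sub>1] wit(2)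
    by (simp add: one_kronecker_one)
  ultimately have "similar_mat_wit (1\<^sub>m n\<^sub>1 \<otimes>\<^sub>K D - (Y \<otimes>\<^sub>K C) * (1\<^sub>m n\<^sub>0 \<otimes>\<^sub>K A') * (X \<otimes>\<^sub>K B))
      (1\<^sub>m n\<^sub>1 \<otimes>\<^sub>K D - Z \<otimes>\<^sub>K ?E) (P \<otimes>\<^sub>K 1\<^sub>m m\<^sub>1) (P' \<otimes>\<^sub>K 1\<^sub>m m\<^sub>1)"
    using carriers
    by (intro similar_mat_witI[where n = "n\<^sub>1 * m\<^sub>1"])
      (auto simp: minus_carrier_mat conj2 simp del: kronecker_dim)
  then have "similar_mat (1\<^sub>m n\<^sub>1 \<otimes>\<^sub>K D - (Y \<otimes>\<^sub>K C) * (1\<^sub>m n\<^sub>0 \<otimes>\<^sub>K A') * (X \<otimes>\<^sub>K B))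
      (1\<^sub>m n\<^sub>1 \<otimes>\<^sub>K D - Z \<otimes>\<^sub>K ?E)"
    unfolding similar_mat_def by blast
  from det_similar[OF this] show ?thesis
    using schur det_one_kronecker[OF A] det_one_kronecker_minus[OF D E wit(5) upper] by simp
qed

section \<open>Values of characteristic polynomials at a point\<close>

text \<open>Evaluation at \<open>x\<close> commutes with the determinant, which reduces polynomial
  determinants to scalar ones.\<close>

lemma poly_char_poly:
  fixes A :: "'a :: field mat"
  assumes "A \<in> carrier_mat n n"
  shows "poly (char_poly A) x = det (x \<cdot>\<^sub>m 1\<^sub>m n - A)"
  unfolding char_poly_def
  by (rule poly_det_cong[of _ n]) (use assms in \<open>auto simp: char_poly_matrix_def\<close>)

text \<open>The product \<open>(p - q) * r\<close> vanishes everywhere, hence is the zero polynomial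
  in characteristic zero, and \<open>r\<close> cancels. It permits discarding the points where the
  resolvent block is singular.\<close>

lemma poly_eq_off_roots:
  fixes p q r :: "'a :: {idom, ring_char_0} poly"
  assumes "r \<noteq> 0" and eq: "\<And>x. poly r x \<noteq> 0 \<Longrightarrow> poly p x = poly q x"
  shows "p = q"
proof -
  have "poly ((p - q) * r) x = 0" for x
    using eq[of x] by (cases "poly r x = 0") auto
  then have "(p - q) * r = 0"
    using poly_all_0_iff_0 by blast
  with assms(1) show ?thesis by simp
qed

text \<open>The point is that \<open>mat_inverse\<close> does not return \<open>None\<close>: an
  invertible matrix is a unit of the matrix ring.\<close>

lemma minv_inverse:
  assumes A: "A \<in> carrier_mat n n" and "invertible_mat A"
  shows "minv A \<in> carrier_mat n n" "A * minv A = 1\<^sub>m n" "minv A * A = 1\<^sub>m n"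
proof -
  obtain B where "A * B = 1\<^sub>m n" "B * A = 1\<^sub>m (dim_row B)"
    using assms by (auto simp: invertible_mat_def inverts_mat_def)
  \<comment> \<open>The shape of \<open>B\<close> is not part of \<open>invertible_mat\<close>; it
    is read off from the two products.\<close>
  moreover from this have "dim_col B = n" "dim_row B = n"
    using A by (metis index_mult_mat(3) index_one_mat(3) carrier_matD(2))+
  ultimately have "A \<in> Units (ring_mat TYPE(complex) n undefined)"
    using A by (auto simp: Units_def ring_mat_def intro!: bexI[of _ B])
  then obtain C where "mat_inverse A = Some C"
    using mat_inverse(1)[OF A, of undefined] by (cases "mat_inverse A") auto
  with mat_inverse(2)[OF A this]
  show "minv A \<in> carrier_mat n n" "A * minv A = 1\<^sub>m n" "minv A * A = 1\<^sub>m n" by auto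
qed

text \<open>The resolvent keeps the Kronecker block shape. The signs go into the second factors, so
  \<open>X\<close> and \<open>Y\<close> stay as they are and a similarity for \<open>Y * X\<close>
  still applies.\<close>

lemma resolvent_four_block_kronecker:
  fixes a b c d X Y :: "'a :: comm_ring_1 mat"
  assumes a: "a \<in> carrier_mat m\<^sub>0 m\<^sub>0" and b: "b \<in> carrier_mat m\<^sub>0 m\<^sub>1"
    and c: "c \<in> carrier_mat m\<^sub>1 m\<^sub>0" and d: "d \<in> carrier_mat m\<^sub>1 m\<^sub>1"
    and X: "X \<in> carrier_mat n\<^sub>0 n\<^sub>1" and Y: "Y \<in> carrier_mat n\<^sub>1 n\<^sub>0"
  shows "x \<cdot>\<^sub>m 1\<^sub>m (n\<^sub>0 * m\<^sub>0 + n\<^sub>1 * m\<^sub>1) -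
      four_block_mat (1\<^sub>m n\<^sub>0 \<otimes>\<^sub>K a) (X \<otimes>\<^sub>K b) (Y \<otimes>\<^sub>K c) (1\<^sub>m n\<^sub>1 \<otimes>\<^sub>K d) =
    four_block_mat (1\<^sub>m n\<^sub>0 \<otimes>\<^sub>K (x \<cdot>\<^sub>m 1\<^sub>m m\<^sub>0 - a)) (X \<otimes>\<^sub>K (- b)) (Y \<otimes>\<^sub>K (- c))
      (1\<^sub>m n\<^sub>1 \<otimes>\<^sub>K (x \<cdot>\<^sub>m 1\<^sub>m m\<^sub>1 - d))"
proof -
  have diag: "x \<cdot>\<^sub>m 1\<^sub>m (n * m) - 1\<^sub>m n \<otimes>\<^sub>K e = 1\<^sub>m n \<otimes>\<^sub>K (x \<cdot>\<^sub>m 1\<^sub>m m - e)"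
    if e: "e \<in> carrier_mat m m" for n m and e :: "'a mat"
  proof (rule eq_matI)
    fix i j
    assume "i < dim_row (1\<^sub>m n \<otimes>\<^sub>K (x \<cdot>\<^sub>m 1\<^sub>m m - e))" "j < dim_col (1\<^sub>m n \<otimes>\<^sub>K (x \<cdot>\<^sub>m 1\<^sub>m m - e))"
    then have i: "i < n * m" and j: "j < n * m" using e by auto
    then show "(x \<cdot>\<^sub>m 1\<^sub>m (n * m) - 1\<^sub>m n \<otimes>\<^sub>K e) $$ (i, j) =
        (1\<^sub>m n \<otimes>\<^sub>K (x \<cdot>\<^sub>m 1\<^sub>m m - e)) $$ (i, j)"
      using e div_mod_less_mult[OF i] div_mod_less_mult[OF j] div_mod_eq_iff[of i m j]
      by (auto simp: kronecker_def)
  qed (use e in auto)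
  have off: "- (W \<otimes>\<^sub>K e) = W \<otimes>\<^sub>K (- e)" for W e :: "'a mat"
    by (intro eq_matI) (auto simp: kronecker_def div_mod_less_mult)
  show ?thesis
    unfolding diag[OF a, symmetric] diag[OF d, symmetric] off[symmetric]
    using assms by (intro eq_matI) auto
qed

lemma poly_char_poly_four_block_kronecker:
  fixes a b c d X Y :: "'a :: field mat"
  assumes a: "a \<in> carrier_mat m\<^sub>0 m\<^sub>0" and b: "b \<in> carrier_mat m\<^sub>0 m\<^sub>1"
    and c: "c \<in> carrier_mat m\<^sub>1 m\<^sub>0" and d: "d \<in> carrier_mat m\<^sub>1 m\<^sub>1"
    and A': "A' \<in> carrier_mat m\<^sub>0 m\<^sub>0" and inv: "(x \<cdot>\<^sub>m 1\<^sub>m m\<^sub>0 - a) * A' = 1\<^sub>m m\<^sub>0"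
    and X: "X \<in> carrier_mat n\<^sub>0 n\<^sub>1" and Y: "Y \<in> carrier_mat n\<^sub>1 n\<^sub>0"
    and wit: "similar_mat_wit (Y * X) Z P P'" and upper: "upper_triangular Z"
  shows "poly (char_poly (four_block_mat (1\<^sub>m n\<^sub>0 \<otimes>\<^sub>K a) (X \<otimes>\<^sub>K b) (Y \<otimes>\<^sub>K c) (1\<^sub>m n\<^sub>1 \<otimes>\<^sub>K d))) x =
    poly (char_poly a) x ^ n\<^sub>0 *
      (\<Prod>k<n\<^sub>1. det (x \<cdot>\<^sub>m 1\<^sub>m m\<^sub>1 - d - Z $$ (k, k) \<cdot>\<^sub>m (c * A' * b)))"
proof -
  \<comment> \<open>The signs of the two off-diagonal blocks cancel in the Schur complement.\<close>
  have "(- c) * A' * (- b) = c * A' * b"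
    using b c A' by (subst uminus_mult_left_mat, simp) (subst uminus_mult_right_mat, auto)
  moreover note M = poly_char_poly[of "four_block_mat (1\<^sub>m n\<^sub>0 \<otimes>\<^sub>K a) (X \<otimes>\<^sub>K b) (Y \<otimes>\<^sub>K c) (1\<^sub>m n\<^sub>1 \<otimes>\<^sub>K d)"
      "n\<^sub>0 * m\<^sub>0 + n\<^sub>1 * m\<^sub>1" x, OF four_block_carrier_mat]
  ultimately show ?thesis
    using det_four_block_kronecker[OF _ _ _ _ A' inv X Y wit upper, of "- b" m\<^sub>1 "- c" "x \<cdot>\<^sub>m 1\<^sub>m m\<^sub>1 - d"]
      a b c d by (simp add: poly_char_poly[OF a] M minus_carrier_mat
        resolvent_four_block_kronecker[OF a b c d X Y])
qed

text \<open>Each off-diagonal block contributes one factor \<open>s\<close> to the Schur complement,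
  so only \<open>s ^ 2\<close> survives there. This is what matches a diagonal entry of
  \<open>T * S\<close>.\<close>

lemma poly_char_poly_scale_off_diagonal:
  assumes H: "H \<in> carrier_mat (m\<^sub>0 + m\<^sub>1) (m\<^sub>0 + m\<^sub>1)"
    and blocks: "split_block H m\<^sub>0 m\<^sub>0 = (H00, H01, H10, H11)"
    and A': "A' \<in> carrier_mat m\<^sub>0 m\<^sub>0" and inv: "(x \<cdot>\<^sub>m 1\<^sub>m m\<^sub>0 - cmat H00) * A' = 1\<^sub>m m\<^sub>0"
  shows "poly (char_poly (scale_off_diagonal m\<^sub>0 H s)) x = poly (char_poly (cmat H00)) x *
    det (x \<cdot>\<^sub>m 1\<^sub>m m\<^sub>1 - cmat H11 - s ^ 2 \<cdot>\<^sub>m (cmat H10 * A' * cmat H01))"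
proof -
  have dims: "dim_row H = m\<^sub>0 + m\<^sub>1" "dim_col H = m\<^sub>0 + m\<^sub>1" using H by auto
  note h = split_block(1-4)[OF blocks dims]
  let ?a = "cmat H00" and ?b = "cmat H01" and ?c = "cmat H10" and ?d = "cmat H11"
  have c: "?a \<in> carrier_mat m\<^sub>0 m\<^sub>0" "?b \<in> carrier_mat m\<^sub>0 m\<^sub>1"
    "?c \<in> carrier_mat m\<^sub>1 m\<^sub>0" "?d \<in> carrier_mat m\<^sub>1 m\<^sub>1" using h by auto
  have "scale_off_diagonal m\<^sub>0 H s = four_block_mat ?a (s \<cdot>\<^sub>m ?b) (s \<cdot>\<^sub>m ?c) ?d"
    by (simp add: scale_off_diagonal_def blocks)
  moreover have "x \<cdot>\<^sub>m 1\<^sub>m (m\<^sub>0 + m\<^sub>1) - four_block_mat ?a (s \<cdot>\<^sub>m ?b) (s \<cdot>\<^sub>m ?c) ?d =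
      four_block_mat (x \<cdot>\<^sub>m 1\<^sub>m m\<^sub>0 - ?a) ((- s) \<cdot>\<^sub>m ?b) ((- s) \<cdot>\<^sub>m ?c) (x \<cdot>\<^sub>m 1\<^sub>m m\<^sub>1 - ?d)"
    using h by (intro eq_matI) auto
  moreover have "((- s) \<cdot>\<^sub>m ?c) * A' * ((- s) \<cdot>\<^sub>m ?b) = s ^ 2 \<cdot>\<^sub>m (?c * A' * ?b)"
    using c A' mult_smult_assoc_mat[OF c(3) A', of "- s"]
      mult_smult_assoc_mat[OF mult_carrier_mat[OF c(3) A'] smult_carrier_mat[OF c(2)], of "- s" "- s"]
      mult_smult_distrib[OF mult_carrier_mat[OF c(3) A'] c(2), of "- s"]
    by (intro eq_matI) (auto simp: power2_eq_square)
  moreover note M = poly_char_poly[OF four_block_carrier_mat[OF c(1,4)],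
      of "s \<cdot>\<^sub>m ?b" "s \<cdot>\<^sub>m ?c" x]
  ultimately show ?thesis
    using c det_schur_complement[OF _ _ _ _ A' inv, of "(- s) \<cdot>\<^sub>m ?b" m\<^sub>1 "(- s) \<cdot>\<^sub>m ?c" "x \<cdot>\<^sub>m 1\<^sub>m m\<^sub>1 - ?d"]
    by (simp add: M poly_char_poly[OF c(1)] minus_carrier_mat)
qed

section \<open>Products of rectangular triangular matrices\<close>

text \<open>A term \<open>T $$ (i, k) * S $$ (k, j)\<close> can be nonzero only if \<open>i\<close>
  \<le> \<open>k\<close> \<le> \<open>j\<close>. On the diagonal this leaves one index, which is
  absent from the sum when it is at least \<open>m\<close>.\<close>

lemma upper_triangular_mult_index:
  fixes S T :: "'a :: semiring_0 mat"
  assumes S: "S \<in> carrier_mat m n" and T: "T \<in> carrier_mat n m"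
    and S_upper: "\<And>i j. i < m \<Longrightarrow> j < n \<Longrightarrow> i > j \<Longrightarrow> S $$ (i, j) = 0"
    and T_upper: "\<And>i j. i < n \<Longrightarrow> j < m \<Longrightarrow> i > j \<Longrightarrow> T $$ (i, j) = 0"
  shows "upper_triangular (T * S)"
    and "k < n \<Longrightarrow> (T * S) $$ (k, k) = (if k < m then T $$ (k, k) * S $$ (k, k) else 0)"
proof -
  have index: "(T * S) $$ (i, j) = (\<Sum>k<m. T $$ (i, k) * S $$ (k, j))" if "i < n" "j < n" for i j
    using that S T by (auto simp: scalar_prod_def atLeast0LessThan)
  have zero: "T $$ (i, k) * S $$ (k, j) = 0" if "i < n" "j < n" "k < m" "k < i \<or> j < k" for i j k
    using that S_upper[of k j] T_upper[of i k] by auto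
  show "upper_triangular (T * S)"
    using S T by (auto simp: index upper_triangular_def simp del: index_mult_mat(1) intro!: sum.neutral zero)
  show "(T * S) $$ (k, k) = (if k < m then T $$ (k, k) * S $$ (k, k) else 0)" if k: "k < n"
  proof -
    have "(\<Sum>i<m. T $$ (k, i) * S $$ (i, k)) =
        (\<Sum>i<m. if i = k then T $$ (k, k) * S $$ (k, k) else 0)"
      using k by (intro sum.cong refl) (auto intro!: zero)
    then show ?thesis using k by (simp add: index)
  qed
qed

section \<open>The characteristic polynomial of the partitioned tensor product\<close>

theorem theorem2:
  fixes G H G00 G01 G10 G11 H00 H01 H10 H11 :: "nat mat"
    and Q R S T :: "complex mat"
    and \<sigma> :: "nat \<Rightarrow> complex"
    and u\<^sub>0 u\<^sub>1 v\<^sub>0 v\<^sub>1 l :: nat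
  assumes G: "G \<in> carrier_mat (u\<^sub>0 + u\<^sub>1) (u\<^sub>0 + u\<^sub>1)"
    and H: "H \<in> carrier_mat (v\<^sub>0 + v\<^sub>1) (v\<^sub>0 + v\<^sub>1)"
    and G_blocks: "split_block G u\<^sub>0 u\<^sub>0 = (G00, G01, G10, G11)"
    and H_blocks: "split_block H v\<^sub>0 v\<^sub>0 = (H00, H01, H10, H11)"
    and l: "l = min u\<^sub>0 u\<^sub>1"
    and Q: "Q \<in> carrier_mat u\<^sub>0 u\<^sub>0" "invertible_mat Q"
    and R: "R \<in> carrier_mat u\<^sub>1 u\<^sub>1" "invertible_mat R"
    and S: "S \<in> carrier_mat u\<^sub>0 u\<^sub>1"
    and T: "T \<in> carrier_mat u\<^sub>1 u\<^sub>0"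
    and G01: "cmat G01 = Q * S * minv R"
    and G10: "cmat G10 = R * T * minv Q"
    and S_upper: "\<And>i j. i < u\<^sub>0 \<Longrightarrow> j < u\<^sub>1 \<Longrightarrow> i > j \<Longrightarrow> S $$ (i, j) = 0"
    and T_upper: "\<And>i j. i < u\<^sub>1 \<Longrightarrow> j < u\<^sub>0 \<Longrightarrow> i > j \<Longrightarrow> T $$ (i, j) = 0"
    and ST_diag: "\<And>j. j < l \<Longrightarrow>
      S $$ (j, j) = T $$ (j, j) \<or> S $$ (j, j) * T $$ (j, j) = 0"
    and \<sigma>: "\<And>j. j < l \<Longrightarrow>
      (\<sigma> j = S $$ (j, j) \<and> S $$ (j, j) = T $$ (j, j)) \<or>
      (\<sigma> j = 0 \<and> S $$ (j, j) * T $$ (j, j) = 0)"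
  shows "(u\<^sub>0 \<ge> u\<^sub>1 \<longrightarrow>
      char_poly (cmat (partitioned_tensor u\<^sub>0 v\<^sub>0 G H)) =
        (\<Prod>j<l. char_poly (scale_off_diagonal v\<^sub>0 H (\<sigma> j))) * char_poly (cmat H00) ^ (u\<^sub>0 - u\<^sub>1)) \<and>
    (u\<^sub>1 \<ge> u\<^sub>0 \<longrightarrow>
      char_poly (cmat (partitioned_tensor u\<^sub>0 v\<^sub>0 G H)) =
        (\<Prod>j<l. char_poly (scale_off_diagonal v\<^sub>0 H (\<sigma> j))) * char_poly (cmat H11) ^ (u\<^sub>1 - u\<^sub>0))"
proof -
  let ?a = "cmat H00" and ?b = "cmat H01" and ?c = "cmat H10" and ?d = "cmat H11"
  let ?M = "cmat (partitioned_tensor u\<^sub>0 v\<^sub>0 G H)"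
  let ?r = "char_poly ?a"
  have G_dims: "dim_row G = u\<^sub>0 + u\<^sub>1" "dim_col G = u\<^sub>0 + u\<^sub>1" using G by auto
  have H_dims: "dim_row H = v\<^sub>0 + v\<^sub>1" "dim_col H = v\<^sub>0 + v\<^sub>1" using H by auto
  note g = split_block(1-4)[OF G_blocks G_dims] and h = split_block(1-4)[OF H_blocks H_dims]
  have X: "cmat G01 \<in> carrier_mat u\<^sub>0 u\<^sub>1" and Y: "cmat G10 \<in> carrier_mat u\<^sub>1 u\<^sub>0"
    using g by auto
  have a: "?a \<in> carrier_mat v\<^sub>0 v\<^sub>0" and b: "?b \<in> carrier_mat v\<^sub>0 v\<^sub>1"
    and c: "?c \<in> carrier_mat v\<^sub>1 v\<^sub>0" and d: "?d \<in> carrier_mat v\<^sub>1 v\<^sub>1"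
    using h by auto
  have cmat_one: "cmat (1\<^sub>m n) = 1\<^sub>m n" for n
    by (intro eq_matI) auto
  have M: "?M = four_block_mat (1\<^sub>m u\<^sub>0 \<otimes>\<^sub>K ?a) (cmat G01 \<otimes>\<^sub>K ?b) (cmat G10 \<otimes>\<^sub>K ?c) (1\<^sub>m u\<^sub>1 \<otimes>\<^sub>K ?d)"
    using g h by (simp add: partitioned_tensor_def G_blocks H_blocks cmat_kronecker cmat_one
        map_four_block_mat[of _ "u\<^sub>0 * v\<^sub>0" "u\<^sub>0 * v\<^sub>0" _ "u\<^sub>1 * v\<^sub>1" _ "u\<^sub>1 * v\<^sub>1"])

  let ?Z = "T * S"
  note Q' = minv_inverse[OF Q] and R' = minv_inverse[OF R]
  \<comment> \<open>Reassociation brings \<open>minv Q\<close> and \<open>Q\<close> together in the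
    middle, where they cancel.\<close>
  have "cmat G10 * cmat G01 = R * ?Z * minv R"
  proof -
    have RT: "R * T \<in> carrier_mat u\<^sub>1 u\<^sub>0" and QS: "Q * S \<in> carrier_mat u\<^sub>0 u\<^sub>1"
      using Q R S T by auto
    have "cmat G10 * cmat G01 = R * T * (minv Q * (Q * S * minv R))"
      unfolding G01 G10 using RT QS Q'(1) R'(1) by (intro assoc_mult_mat[of _ u\<^sub>1 u\<^sub>0 _ u\<^sub>0 _ u\<^sub>1]) auto
    also have "minv Q * (Q * S * minv R) = minv Q * (Q * S) * minv R"
      using QS Q'(1) R'(1) by (intro assoc_mult_mat[symmetric]) auto
    also have "minv Q * (Q * S) = minv Q * Q * S"
      using Q(1) S Q'(1) by (intro assoc_mult_mat[symmetric]) auto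
    also have "\<dots> = S"
      using Q'(3) S by simp
    also have "R * T * (S * minv R) = R * T * S * minv R"
      using RT S R'(1) by (intro assoc_mult_mat[symmetric]) auto
    also have "R * T * S = R * ?Z"
      using R(1) T S by (intro assoc_mult_mat) auto
    finally show ?thesis .
  qed
  then have wit: "similar_mat_wit (cmat G10 * cmat G01) ?Z R (minv R)"
    using X Y R(1) R' S T by (intro similar_mat_witI[where n = u\<^sub>1]) auto
  have upper: "upper_triangular ?Z"
    and Z_diag: "k < u\<^sub>1 \<Longrightarrow> ?Z $$ (k, k) = (if k < u\<^sub>0 then T $$ (k, k) * S $$ (k, k) else 0)" for k
    using upper_triangular_mult_index[OF S T S_upper T_upper] by blast+
  \<comment> \<open>Both alternatives for \<open>\<sigma> k\<close> give its square as the product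
    of the diagonal entries. An index \<open>k\<close> with \<open>l\<close> \<le> \<open>k\<close>
    and \<open>k < u\<^sub>1\<close> forces \<open>l = u\<^sub>0\<close>, so the entry is 0.\<close>
  have Z_\<sigma>: "?Z $$ (k, k) = (if k < l then \<sigma> k ^ 2 else 0)" if "k < u\<^sub>1" for k
    using that Z_diag[OF that] \<sigma>[of k] by (auto simp: l power2_eq_square mult.commute)

  \<comment> \<open>A characteristic polynomial is monic.\<close>
  have "?r \<noteq> 0"
    using degree_monic_char_poly[OF a] by auto
  \<comment> \<open>Subtraction is truncated, so at least one of the two exponents is 0 and a single
    formula covers both cases of the theorem.\<close>
  moreover have "poly (char_poly ?M) x =
        poly (\<Prod>j<l. char_poly (scale_off_diagonal v\<^sub>0 H (\<sigma> j))) x * poly ?r x ^ (u\<^sub>0 - u\<^sub>1) *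
        poly (char_poly ?d) x ^ (u\<^sub>1 - u\<^sub>0)"
    if x: "poly ?r x \<noteq> 0" for x
  proof -
    let ?A = "x \<cdot>\<^sub>m 1\<^sub>m v\<^sub>0 - ?a"
    \<comment> \<open>The value of \<open>?r\<close> at \<open>x\<close> is the determinant of
      \<open>?A\<close>.\<close>
    have "?A \<in> Units (ring_mat TYPE(complex) v\<^sub>0 undefined)"
      using x a by (intro det_non_zero_imp_unit) (auto simp: poly_char_poly)
    then obtain A' where A': "A' \<in> carrier_mat v\<^sub>0 v\<^sub>0" and inv: "?A * A' = 1\<^sub>m v\<^sub>0"
      by (auto simp: Units_def ring_mat_def)
    \<comment> \<open>The factor that a diagonal entry \<open>s\<close> of \<open>?Z\<close>
      contributes: a padding zero yields the value of \<open>char_poly ?d\<close>, while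
      \<open>\<sigma> k ^ 2\<close> yields, up to the value of \<open>?r\<close>, that of the scaled
      matrix.\<close>
    define f where "f s = det (x \<cdot>\<^sub>m 1\<^sub>m v\<^sub>1 - ?d - s \<cdot>\<^sub>m (?c * A' * ?b))" for s
    have f0: "f 0 = poly (char_poly ?d) x"
    proof -
      have "x \<cdot>\<^sub>m 1\<^sub>m v\<^sub>1 - ?d - 0 \<cdot>\<^sub>m (?c * A' * ?b) = x \<cdot>\<^sub>m 1\<^sub>m v\<^sub>1 - ?d"
        using b c d by (intro eq_matI) auto
      then show ?thesis by (simp add: f_def poly_char_poly[OF d])
    qed
    have "(\<Prod>k<u\<^sub>1. f (?Z $$ (k, k))) = (\<Prod>k<u\<^sub>1. f (if k < l then \<sigma> k ^ 2 else 0))"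
      by (intro prod.cong) (auto simp: Z_\<sigma>)
    also have "\<dots> = (\<Prod>k<l. f (if k < l then \<sigma> k ^ 2 else 0)) *
        (\<Prod>k\<in>{l..<u\<^sub>1}. f (if k < l then \<sigma> k ^ 2 else 0))"
      by (subst prod.union_disjoint[symmetric]) (auto simp: l intro!: prod.cong)
    also have "\<dots> = (\<Prod>k<l. f (\<sigma> k ^ 2)) * f 0 ^ (u\<^sub>1 - u\<^sub>0)"
      by (simp add: l min_def)
    finally have "poly (char_poly ?M) x = poly ?r x ^ u\<^sub>0 * (\<Prod>k<l. f (\<sigma> k ^ 2)) * f 0 ^ (u\<^sub>1 - u\<^sub>0)"
      using poly_char_poly_four_block_kronecker[OF a b c d A' inv X Y wit upper]
      by (simp add: M f_def[symmetric])
    \<comment> \<open>Of the \<open>u\<^sub>0\<close> copies, \<open>l\<close> complete the factors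
      \<open>f (\<sigma> k ^ 2)\<close> to values of the scaled characteristic polynomials; the rest
      form the remaining power.\<close>
    also have "poly ?r x ^ u\<^sub>0 = poly ?r x ^ l * poly ?r x ^ (u\<^sub>0 - u\<^sub>1)"
      by (simp add: l power_add[symmetric] min_def)
    finally show ?thesis
      by (simp add: f0 poly_prod prod.distrib f_def[symmetric]
          poly_char_poly_scale_off_diagonal[OF H H_blocks A' inv])
  qed
  ultimately have "char_poly ?M = (\<Prod>j<l. char_poly (scale_off_diagonal v\<^sub>0 H (\<sigma> j))) *
      ?r ^ (u\<^sub>0 - u\<^sub>1) * char_poly ?d ^ (u\<^sub>1 - u\<^sub>0)"
    by (intro poly_eq_off_roots[of ?r]) auto
  then show ?thesis by auto
qed

end
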